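(* Let $n<\infty$. Then there is no expander graph family $(G_i)_{i\in\mathbb{N}}$ satisfying $CD(0,n)$ (that is, such that every $G_i$ satisfies $CD(0,n)$).
   Context: A finite graph $G=(V,q)$ consists of a finite set $V$ and a function $q:V^2\to[0,\infty)$ with $q(x,x)=0$ for all $x\in V$. A combinatorial undirected graph is one with $q(x,y)=q(y,x)\in\{0,1\}$ for all $x,y$; the degree of $x$ is $\sum_y q(x,y)$. $C(V)=\mathbb{R}^V$. The Laplacian is $\Delta f(x)=\sum_{y}q(x,y)(f(y)-f(x))$, also written $\Delta_G$. The operators $\Gamma_k:C(V)\times C(V)\to C(V)$ are defined by $\Gamma_0(f,g)=fg$ and $2\Gamma_{k+1}(f,g)=\Delta\Gamma_k(f,g)-\Gamma_k(f,\Delta g)-\Gamma_k(\Delta f,g)$; write $\Gamma_k f=\Gamma_k(f,f)$ and $\Gamma=\Gamma_1$. $G$ satisfies $CD(K,n)$ if $\Gamma_2 f\ge\frac1n(\Delta f)^2+K\,\Gamma f$ pointwise on $V$ for all $f\in C(V)$. An expander graph family is a growing family $(G_i)=((V_i,q_i))$ of finite combinatorial undirected graphs (growing meaning $|V_i|\to\infty$) of constant degree $D$ (the same $D$ for all vertices and all $i$), such that the first positive eigenvalue of $-\Delta_{G_i}$ is uniformly lower bounded by some $\lambda>0$.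
   Formalization: Each graph of the expander family is required to be connected (and n > 0); without connectedness the claim fails: growing disjoint unions of K_2 have constant degree 1, first positive eigenvalue 2, and satisfy CD(0,1). *)

theory Defs
  imports Complex_Main
begin

text \<open>
  A graph is given by a vertex set \<open>V\<close> in an ambient type and a weight function \<open>q\<close>; only the
  values of \<open>q\<close> on \<open>V \<times> V\<close> matter. A function in $C(V)$ is represented by any extension to the
  whole type: at points of \<open>V\<close>, the operators below depend only on the values on \<open>V\<close>.
\<close>

definition finite_graph :: "'a set \<Rightarrow> ('a \<Rightarrow> 'a \<Rightarrow> real) \<Rightarrow> bool" where
  "finite_graph V q \<longleftrightarrow>
     finite V \<and> (\<forall>x\<in>V. \<forall>y\<in>V. 0 \<le> q x y) \<and> (\<forall>x\<in>V. q x x = 0)"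

definition combinatorial_undirected :: "'a set \<Rightarrow> ('a \<Rightarrow> 'a \<Rightarrow> real) \<Rightarrow> bool" where
  "combinatorial_undirected V q \<longleftrightarrow>
     finite_graph V q \<and> (\<forall>x\<in>V. \<forall>y\<in>V. q x y = q y x \<and> q x y \<in> {0, 1})"

definition degree :: "'a set \<Rightarrow> ('a \<Rightarrow> 'a \<Rightarrow> real) \<Rightarrow> 'a \<Rightarrow> real" where
  "degree V q x = (\<Sum>y\<in>V. q x y)"

definition connected_graph :: "'a set \<Rightarrow> ('a \<Rightarrow> 'a \<Rightarrow> real) \<Rightarrow> bool" where
  "connected_graph V q \<longleftrightarrow>
     (\<forall>x\<in>V. \<forall>y\<in>V. (x, y) \<in> {(u, v). u \<in> V \<and> v \<in> V \<and> 0 < q u v}\<^sup>*)"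

definition laplacian :: "'a set \<Rightarrow> ('a \<Rightarrow> 'a \<Rightarrow> real) \<Rightarrow> ('a \<Rightarrow> real) \<Rightarrow> 'a \<Rightarrow> real" where
  "laplacian V q f x = (\<Sum>y\<in>V. q x y * (f y - f x))"

primrec gamma_op ::
  "'a set \<Rightarrow> ('a \<Rightarrow> 'a \<Rightarrow> real) \<Rightarrow> nat \<Rightarrow> ('a \<Rightarrow> real) \<Rightarrow> ('a \<Rightarrow> real) \<Rightarrow> 'a \<Rightarrow> real" where
  "gamma_op V q 0 f g = (\<lambda>x. f x * g x)"
| "gamma_op V q (Suc k) f g = (\<lambda>x.
     (laplacian V q (gamma_op V q k f g) x
      - gamma_op V q k f (laplacian V q g) x
      - gamma_op V q k (laplacian V q f) g x) / 2)"

definition CD :: "'a set \<Rightarrow> ('a \<Rightarrow> 'a \<Rightarrow> real) \<Rightarrow> real \<Rightarrow> real \<Rightarrow> bool" where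
  "CD V q K n \<longleftrightarrow>
     (\<forall>f. \<forall>x\<in>V. gamma_op V q 2 f f x \<ge> 1 / n * (laplacian V q f x)\<^sup>2 + K * gamma_op V q 1 f f x)"

definition eigenvalue_neg_laplacian :: "'a set \<Rightarrow> ('a \<Rightarrow> 'a \<Rightarrow> real) \<Rightarrow> real \<Rightarrow> bool" where
  "eigenvalue_neg_laplacian V q \<mu> \<longleftrightarrow>
     (\<exists>f. (\<exists>x\<in>V. f x \<noteq> 0) \<and> (\<forall>x\<in>V. - laplacian V q f x = \<mu> * f x))"

definition first_positive_eigenvalue :: "'a set \<Rightarrow> ('a \<Rightarrow> 'a \<Rightarrow> real) \<Rightarrow> real \<Rightarrow> bool" where
  "first_positive_eigenvalue V q \<mu> \<longleftrightarrow>
     0 < \<mu> \<and> eigenvalue_neg_laplacian V q \<mu> \<and>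
     (\<forall>\<nu>. 0 < \<nu> \<and> eigenvalue_neg_laplacian V q \<nu> \<longrightarrow> \<mu> \<le> \<nu>)"

text \<open>
  Expander graphs are connected, and this has to be said explicitly: the first positive eigenvalue
  does not see the number of components. Disjoint unions of more and more copies of $K_2$ have
  constant degree $1$ and first positive eigenvalue $2$, and they satisfy $CD(0,1)$.
\<close>

definition expander_family :: "(nat \<Rightarrow> 'a set) \<Rightarrow> (nat \<Rightarrow> 'a \<Rightarrow> 'a \<Rightarrow> real) \<Rightarrow> bool" where
  "expander_family V q \<longleftrightarrow>
     (\<forall>i. combinatorial_undirected (V i) (q i)) \<and>
     (\<forall>i. connected_graph (V i) (q i)) \<and>
     filterlim (\<lambda>i. card (V i)) at_top sequentially \<and>
     (\<exists>D::nat. \<forall>i. \<forall>x\<in>V i. degree (V i) (q i) x = real D) \<and>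
     (\<exists>l>0. \<forall>i. \<exists>\<mu>. first_positive_eigenvalue (V i) (q i) \<mu> \<and> l \<le> \<mu>)"

end

theory Submission
  imports Defs "HOL-Analysis.Convex" "HOL-Analysis.Function_Topology"
begin

text \<open>
  For the resolvent $R = (1 - \varepsilon\Delta)^{-1}$ and $f$ with values in $[-1,1]$, nonnegative
  curvature gives $\Gamma(Rf) \le R\,\Gamma f$ and $2\varepsilon R\,\Gamma(Rf) \le R f^2 \le 1$, hence
  $2\varepsilon\Gamma(R^2 f) \le 1$. So the rows $p(x,\cdot)$, $p(y,\cdot)$ of the Markov kernel $p$ of
  $R^2$ differ by at most $\varepsilon^{-1/2}$ in $\ell^1$ when $x \sim y$, and the unit vectors
  $\xi_x = \sqrt{p(x,\cdot)} \in \ell^2(V)$ satisfy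
  $\|\xi_x - \xi_y\|^2 \le \varepsilon^{-1/2}$. On the other hand $p(x,\cdot)$ has mean displacement
  at most $2\varepsilon D$, so for fixed $\varepsilon$ and $|V| \to \infty$ most pairs $\xi_x$, $\xi_y$
  are almost orthogonal. This contradicts the Poincare inequality for $x \mapsto \xi_x$ once
  $\varepsilon$ is large: as for the failure of property A, an expander admits no such $\xi$.
\<close>

section \<open>The carre du champ in closed form, and \<Gamma>_2 in Bochner form\<close>

definition grad_prod ::
  "'a set \<Rightarrow> ('a \<Rightarrow> 'a \<Rightarrow> real) \<Rightarrow> ('a \<Rightarrow> real) \<Rightarrow> ('a \<Rightarrow> real) \<Rightarrow> 'a \<Rightarrow> real" where
  "grad_prod V q f g x = (\<Sum>y\<in>V. q x y * ((f y - f x) * (g y - g x))) / 2"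

lemma gamma_op_1: "gamma_op V q 1 f g = grad_prod V q f g"
  by (rule ext)
    (simp add: grad_prod_def laplacian_def sum_distrib_left sum_subtractf[symmetric] algebra_simps)

lemma grad_prod_commute: "grad_prod V q f g x = grad_prod V q g f x"
  by (simp add: grad_prod_def mult.commute)

lemma gamma_op_2:
  "gamma_op V q 2 f f x
    = laplacian V q (grad_prod V q f f) x / 2 - grad_prod V q f (laplacian V q f) x"
proof -
  have "gamma_op V q 2 f f x
    = (laplacian V q (gamma_op V q 1 f f) x - gamma_op V q 1 f (laplacian V q f) x
      - gamma_op V q 1 (laplacian V q f) f x) / 2"
    by (simp add: numeral_2_eq_2)
  then show ?thesis
    unfolding gamma_op_1 using grad_prod_commute[of V q "laplacian V q f" f x]
    by (simp add: field_simps)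
qed

section \<open>Calculus of the Laplacian on a regular graph\<close>

locale regular_graph =
  fixes V :: "'a set" and q :: "'a \<Rightarrow> 'a \<Rightarrow> real" and D :: nat
  assumes finite_V: "finite V"
    and q_01: "\<lbrakk>x \<in> V; y \<in> V\<rbrakk> \<Longrightarrow> q x y \<in> {0, 1}"
    and q_sym: "\<lbrakk>x \<in> V; y \<in> V\<rbrakk> \<Longrightarrow> q x y = q y x"
    and q_sum: "x \<in> V \<Longrightarrow> (\<Sum>y\<in>V. q x y) = real D"
begin

abbreviation lap :: "('a \<Rightarrow> real) \<Rightarrow> 'a \<Rightarrow> real" where
  "lap \<equiv> laplacian V q"

abbreviation gam :: "('a \<Rightarrow> real) \<Rightarrow> ('a \<Rightarrow> real) \<Rightarrow> 'a \<Rightarrow> real" where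
  "gam \<equiv> grad_prod V q"

lemma q_nonneg: "\<lbrakk>x \<in> V; y \<in> V\<rbrakk> \<Longrightarrow> 0 \<le> q x y"
  using q_01[of x y] by auto

lemma edge_square_nonneg: "\<lbrakk>x \<in> V; y \<in> V\<rbrakk> \<Longrightarrow> 0 \<le> q x y * (a * a)"
  by (rule mult_nonneg_nonneg[OF q_nonneg]) auto

lemma gam_cong:
  "\<lbrakk>x \<in> V; \<And>y. y \<in> V \<Longrightarrow> f y = f' y; \<And>y. y \<in> V \<Longrightarrow> g y = g' y\<rbrakk> \<Longrightarrow> gam f g x = gam f' g' x"
  by (simp add: grad_prod_def)

lemma lap_add: "lap (\<lambda>x. f x + g x) x = lap f x + lap g x"
  by (simp add: laplacian_def sum.distrib[symmetric] algebra_simps)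

lemma lap_diff: "lap (\<lambda>x. f x - g x) x = lap f x - lap g x"
  by (simp add: laplacian_def sum_subtractf[symmetric] algebra_simps)

lemma lap_cmult: "lap (\<lambda>x. c * f x) x = c * lap f x"
  by (simp add: laplacian_def sum_distrib_left algebra_simps)

lemma lap_const: "lap (\<lambda>x. c) x = 0"
  by (simp add: laplacian_def)

lemma lap_sum: "lap (\<lambda>x. \<Sum>i\<in>I. f i x) x = (\<Sum>i\<in>I. lap (f i) x)"
proof -
  have "lap (\<lambda>x. \<Sum>i\<in>I. f i x) x = (\<Sum>y\<in>V. \<Sum>i\<in>I. q x y * (f i y - f i x))"
    unfolding laplacian_def by (simp add: sum_subtractf[symmetric] sum_distrib_left)
  also have "\<dots> = (\<Sum>i\<in>I. \<Sum>y\<in>V. q x y * (f i y - f i x))"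
    by (rule sum.swap)
  finally show ?thesis by (simp add: laplacian_def)
qed

lemma lap_eq: "x \<in> V \<Longrightarrow> lap f x = (\<Sum>y\<in>V. q x y * f y) - real D * f x"
  by (simp add: laplacian_def right_diff_distrib sum_subtractf sum_distrib_right[symmetric] q_sum)

lemma gam_self_nonneg: "x \<in> V \<Longrightarrow> 0 \<le> gam f f x"
  unfolding grad_prod_def by (intro divide_nonneg_nonneg sum_nonneg edge_square_nonneg) auto

text \<open>Exchanging the endpoints of each edge, by symmetry of \<open>q\<close>, gives a second
  expression for the left side. The average of the two expressions is the Dirichlet form.\<close>

lemma green: "(\<Sum>x\<in>V. f x * lap g x) = - (\<Sum>x\<in>V. gam f g x)"
proof -
  have a: "(\<Sum>x\<in>V. f x * lap g x) = (\<Sum>x\<in>V. \<Sum>y\<in>V. q x y * (f x * (g y - g x)))"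
    by (simp add: laplacian_def sum_distrib_left algebra_simps)
  also have "\<dots> = (\<Sum>y\<in>V. \<Sum>x\<in>V. q x y * (f x * (g y - g x)))"
    by (rule sum.swap)
  also have "\<dots> = (\<Sum>x\<in>V. \<Sum>y\<in>V. q x y * (f y * (g x - g y)))"
    by (intro sum.cong refl) (simp add: q_sym)
  finally have b: "(\<Sum>x\<in>V. f x * lap g x) = (\<Sum>x\<in>V. \<Sum>y\<in>V. q x y * (f y * (g x - g y)))" .
  have "2 * (\<Sum>x\<in>V. f x * lap g x)
      = (\<Sum>x\<in>V. \<Sum>y\<in>V. q x y * (f x * (g y - g x)) + q x y * (f y * (g x - g y)))"
    using a b by (simp add: sum.distrib)
  also have "\<dots> = (\<Sum>x\<in>V. \<Sum>y\<in>V. - (q x y * ((f y - f x) * (g y - g x))))"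
    by (intro sum.cong refl) (simp add: algebra_simps)
  also have "\<dots> = - 2 * (\<Sum>x\<in>V. gam f g x)"
    by (simp add: grad_prod_def sum_negf sum_divide_distrib[symmetric])
  finally show ?thesis by simp
qed

lemma lap_self_adjoint: "(\<Sum>x\<in>V. f x * lap g x) = (\<Sum>x\<in>V. lap f x * g x)"
proof -
  have "(\<Sum>x\<in>V. f x * lap g x) = (\<Sum>x\<in>V. g x * lap f x)"
    unfolding green by (simp add: grad_prod_commute)
  then show ?thesis by (simp add: mult.commute)
qed

lemma sum_lap: "(\<Sum>x\<in>V. lap g x) = 0"
  using lap_self_adjoint[of "\<lambda>_. 1" g] by (simp add: lap_const)

lemma lap_square: "lap (\<lambda>x. f x * f x) x = 2 * (f x * lap f x) + 2 * gam f f x"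
proof -
  have "lap (\<lambda>x. f x * f x) x
      = (\<Sum>y\<in>V. 2 * (f x * (q x y * (f y - f x))) + q x y * ((f y - f x) * (f y - f x)))"
    unfolding laplacian_def by (intro sum.cong refl) algebra
  then show ?thesis
    unfolding laplacian_def grad_prod_def sum.distrib sum_distrib_left[symmetric] by simp
qed

section \<open>Maximum principle and resolvent\<close>

lemma maximum_principle:
  assumes e: "0 \<le> e" and h: "\<And>x. x \<in> V \<Longrightarrow> 0 \<le> g x - e * lap g x" and x: "x \<in> V"
  shows "0 \<le> g x"
proof -
  have "Min (g ` V) \<in> g ` V" using finite_V x by (intro Min_in) auto
  then obtain m where m: "m \<in> V" "Min (g ` V) = g m" by auto
  have le: "g m \<le> g y" if "y \<in> V" for y
    using that finite_V m(2) by (metis Min_le finite_imageI image_eqI)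
  \<comment> \<open>At the minimum point \<open>m\<close> the Laplacian is nonnegative, so the
    hypothesis there reads \<open>g m \<ge> e * lap g m \<ge> 0\<close>.\<close>
  have "0 \<le> lap g m"
    unfolding laplacian_def using le m(1) by (intro sum_nonneg mult_nonneg_nonneg q_nonneg) auto
  then have "0 \<le> g m" using h[OF m(1)] e by (smt (verit) mult_nonneg_nonneg)
  then show ?thesis using le[OF x] by simp
qed

text \<open>With A the adjacency operator, the equation is (1 + e D) g - e A g = f. After division
  by 1 + e D it is solved by a Neumann series in c A, which converges because A has sup norm at most
  D and \<open>c * real D < 1\<close>.\<close>

lemma resolvent_exists:
  assumes e: "0 \<le> e"
  shows "\<exists>g. \<forall>x\<in>V. g x - e * lap g x = f x"
proof -
  define c where "c = e / (1 + e * real D)"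
  define a where "a j = ((\<lambda>g x. c * (\<Sum>y\<in>V. q x y * g y)) ^^ j) f" for j
  have pos: "0 < 1 + e * real D" using e by (simp add: add_pos_nonneg)
  have c0: "0 \<le> c" using e pos by (simp add: c_def)
  have cD: "0 \<le> c * real D" "c * real D < 1" using c0 pos by (auto simp: c_def field_simps)
  have a_Suc: "a (Suc j) x = c * (\<Sum>y\<in>V. q x y * a j y)" for j x
    by (simp add: a_def)
  define M where "M = (\<Sum>x\<in>V. \<bar>f x\<bar>)"
  have bound: "\<forall>x\<in>V. \<bar>a j x\<bar> \<le> (c * real D) ^ j * M" for j
  proof (induction j)
    case 0
    show ?case using finite_V by (auto simp: a_def M_def intro: member_le_sum)
  next
    case (Suc j)
    show ?case
    proof
      fix x assume x: "x \<in> V"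
      have "\<bar>\<Sum>y\<in>V. q x y * a j y\<bar> \<le> (\<Sum>y\<in>V. q x y * ((c * real D) ^ j * M))"
        using x Suc by (intro sum_abs[THEN order_trans] sum_mono)
          (auto simp: abs_mult q_nonneg intro!: mult_left_mono)
      also have "\<dots> = real D * ((c * real D) ^ j * M)"
        using x by (simp add: sum_distrib_right[symmetric] q_sum)
      finally show "\<bar>a (Suc j) x\<bar> \<le> (c * real D) ^ Suc j * M"
        using mult_left_mono[OF _ c0] by (fastforce simp: a_Suc abs_mult c0 mult_ac)
    qed
  qed
  have summ: "summable (\<lambda>j. a j x)" if "x \<in> V" for x
  proof (rule summable_comparison_test')
    show "summable (\<lambda>j. (c * real D) ^ j * M)"
      using cD by (intro summable_mult2 summable_geometric) auto
    show "norm (a j x) \<le> (c * real D) ^ j * M" for j using bound that by auto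
  qed
  define G where "G x = (\<Sum>j. a j x)" for x
  have G: "G x = f x + c * (\<Sum>y\<in>V. q x y * G y)" if x: "x \<in> V" for x
  proof -
    have "(\<Sum>j. a (Suc j) x) = c * (\<Sum>j. \<Sum>y\<in>V. q x y * a j y)"
      unfolding a_Suc by (intro suminf_mult summable_sum summable_mult summ)
    also have "(\<Sum>j. \<Sum>y\<in>V. q x y * a j y) = (\<Sum>y\<in>V. \<Sum>j. q x y * a j y)"
      by (intro suminf_sum summable_mult summ)
    also have "\<dots> = (\<Sum>y\<in>V. q x y * G y)"
      unfolding G_def by (intro sum.cong refl suminf_mult summ)
    finally have "(\<Sum>j. a (Suc j) x) = c * (\<Sum>y\<in>V. q x y * G y)" .
    moreover have "a 0 x = f x" by (simp add: a_def)
    ultimately show ?thesis using suminf_split_head[OF summ[OF x]] by (simp add: G_def)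
  qed
  \<comment> \<open>\<open>G = f + c A G\<close> means that \<open>G\<close> solves the equation
    with right side (1 + e D) f, hence the rescaling.\<close>
  have "1 / (1 + e * real D) * G x - e * lap (\<lambda>x. 1 / (1 + e * real D) * G x) x = f x"
    if x: "x \<in> V" for x
  proof -
    have "(1 + e * real D) * G x = (1 + e * real D) * f x + e * (\<Sum>y\<in>V. q x y * G y)"
      using pos by (subst G[OF x]) (simp add: c_def field_simps)
    then have "G x - e * lap G x = (1 + e * real D) * f x"
      by (simp add: lap_eq x algebra_simps)
    then have "1 / (1 + e * real D) * (G x - e * lap G x) = f x" using pos by simp
    then show ?thesis unfolding lap_cmult by (simp add: right_diff_distrib mult.left_commute)
  qed
  then show ?thesis by (intro exI ballI)
qed

text \<open>For \<open>0 \<le> e\<close> the choice is determined on \<open>V\<close>, see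
  \<open>res_unique\<close>. Its values elsewhere are arbitrary but invisible to the operators at
  points of \<open>V\<close>.\<close>

definition res :: "real \<Rightarrow> ('a \<Rightarrow> real) \<Rightarrow> 'a \<Rightarrow> real" where
  "res e f = (SOME g. \<forall>x\<in>V. g x - e * lap g x = f x)"

context
  fixes e :: real
  assumes e: "0 \<le> e"
begin

lemma res_eq: "x \<in> V \<Longrightarrow> res e f x - e * lap (res e f) x = f x"
  using someI_ex[OF resolvent_exists[OF e, of f]] unfolding res_def by blast

text \<open>Comparison with a subsolution. Together with \<open>res_le\<close>, it reduces a
  pointwise bound on the resolvent to an inequality for 1 - e \<Delta> applied to an explicit
  function.\<close>

lemma res_ge:
  assumes "\<And>x. x \<in> V \<Longrightarrow> g x - e * lap g x \<le> f x" and "x \<in> V"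
  shows "g x \<le> res e f x"
proof -
  have "0 \<le> res e f x - g x"
    by (rule maximum_principle[OF e _ assms(2)])
      (use assms(1) res_eq in \<open>fastforce simp: lap_diff algebra_simps\<close>)
  then show ?thesis by simp
qed

lemma res_le:
  assumes "\<And>x. x \<in> V \<Longrightarrow> f x \<le> g x - e * lap g x" and "x \<in> V"
  shows "res e f x \<le> g x"
proof -
  have "0 \<le> g x - res e f x"
    by (rule maximum_principle[OF e _ assms(2)])
      (use assms(1) res_eq in \<open>fastforce simp: lap_diff algebra_simps\<close>)
  then show ?thesis by simp
qed

lemma res_unique:
  assumes "\<And>x. x \<in> V \<Longrightarrow> g x - e * lap g x = f x" and "x \<in> V"
  shows "res e f x = g x"
  using res_le[of f g x] res_ge[of g f x] assms by force

lemma res_nonneg: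
  assumes "\<And>x. x \<in> V \<Longrightarrow> 0 \<le> f x" and "x \<in> V"
  shows "0 \<le> res e f x"
  using res_ge[of "\<lambda>_. 0" f x] assms by (simp add: lap_const)

lemma res_self_adjoint: "(\<Sum>x\<in>V. res e f x * g x) = (\<Sum>x\<in>V. f x * res e g x)"
proof -
  have "(\<Sum>x\<in>V. res e f x * g x) = (\<Sum>x\<in>V. res e f x * (res e g x - e * lap (res e g) x))"
    by (simp add: res_eq)
  also have "\<dots> = (\<Sum>x\<in>V. res e f x * res e g x) - e * (\<Sum>x\<in>V. res e f x * lap (res e g) x)"
    by (simp add: sum_subtractf sum_distrib_left algebra_simps)
  also have "\<dots> = (\<Sum>x\<in>V. res e f x * res e g x) - e * (\<Sum>x\<in>V. lap (res e f) x * res e g x)"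
    by (simp only: lap_self_adjoint)
  also have "\<dots> = (\<Sum>x\<in>V. (res e f x - e * lap (res e f) x) * res e g x)"
    by (simp add: sum_subtractf sum_distrib_left algebra_simps)
  finally show ?thesis by (simp add: res_eq)
qed

section \<open>Gradient estimates under nonnegative curvature\<close>

lemma gam_resolvent_ge:
  assumes CD: "\<And>x. x \<in> V \<Longrightarrow> 0 \<le> gamma_op V q 2 g g x" and x: "x \<in> V"
  shows "gam g g x - e * lap (gam g g) x \<le> gam (\<lambda>x. g x - e * lap g x) (\<lambda>x. g x - e * lap g x) x"
proof -
  have "gam (\<lambda>x. g x - e * lap g x) (\<lambda>x. g x - e * lap g x) x
      = gam g g x - 2 * e * gam g (lap g) x + e\<^sup>2 * gam (lap g) (lap g) x"
  proof -
    have "(\<Sum>y\<in>V. q x y * ((g y - e * lap g y - (g x - e * lap g x))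
          * (g y - e * lap g y - (g x - e * lap g x))))
        = (\<Sum>y\<in>V. q x y * ((g y - g x) * (g y - g x))
            - 2 * e * (q x y * ((g y - g x) * (lap g y - lap g x)))
            + e\<^sup>2 * (q x y * ((lap g y - lap g x) * (lap g y - lap g x))))"
      by (intro sum.cong refl) algebra
    then show ?thesis
      unfolding grad_prod_def sum.distrib sum_subtractf sum_distrib_left[symmetric]
      by (simp add: add_divide_distrib diff_divide_distrib)
  qed
  \<comment> \<open>The term quadratic in \<open>e\<close> is dropped by positivity. The mixed term
    is then bounded by \<Gamma>_2 \<ge> 0 in its Bochner form; this is the one place where curvature
    itself enters, and later results only pass it on.\<close>
  moreover have "0 \<le> e\<^sup>2 * gam (lap g) (lap g) x"
    using gam_self_nonneg[OF x] by simp
  moreover have "e * gam g (lap g) x \<le> e * (lap (gam g g) x / 2)"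
    using CD[OF x] e unfolding gamma_op_2 by (intro mult_left_mono) auto
  ultimately show ?thesis by (simp add: algebra_simps)
qed

text \<open>By \<open>gam_resolvent_ge\<close>, \<Gamma>(R f) is a subsolution for the right side
  \<Gamma> f. This is the resolvent analogue of the Bakry-Emery commutation of gradient and heat
  semigroup.\<close>

lemma gradient_estimate:
  assumes CD: "\<And>f x. x \<in> V \<Longrightarrow> 0 \<le> gamma_op V q 2 f f x" and x: "x \<in> V"
  shows "gam (res e f) (res e f) x \<le> res e (gam f f) x"
proof (rule res_ge[OF _ x])
  fix y assume y: "y \<in> V"
  have "gam (\<lambda>x. res e f x - e * lap (res e f) x) (\<lambda>x. res e f x - e * lap (res e f) x) y
      = gam f f y"
    by (intro gam_cong y res_eq)
  then show "gam (res e f) (res e f) y - e * lap (gam (res e f) (res e f)) y \<le> gam f f y"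
    using gam_resolvent_ge[OF CD y, of "res e f"] by simp
qed

text \<open>Let g = R f. Applying 1 - e \<Delta> to g^2 gives f^2 - (e \<Delta> g)^2 - 2 e \<Gamma>
  g, and applying it to 2 e R \<Gamma> g restores the last term. So g^2 + 2 e R \<Gamma> g is at
  most 1 by the maximum principle. The second resolvent in the statement comes from replacing R
  \<Gamma> g by \<Gamma>(R g).\<close>

lemma reverse_poincare:
  assumes CD: "\<And>f x. x \<in> V \<Longrightarrow> 0 \<le> gamma_op V q 2 f f x"
    and f: "\<And>x. x \<in> V \<Longrightarrow> \<bar>f x\<bar> \<le> 1" and x: "x \<in> V"
  shows "2 * e * gam (res e (res e f)) (res e (res e f)) x \<le> 1"
proof -
  let ?g = "res e f"
  let ?u = "res e (gam ?g ?g)"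
  have "?g y * ?g y + 2 * e * ?u y \<le> 1" if y: "y \<in> V" for y
  proof -
    have "0 \<le> 1 - (?g y * ?g y + 2 * e * ?u y)"
    proof (rule maximum_principle[OF e _ y])
      fix z assume z: "z \<in> V"
      have "f z * f z = (?g z - e * lap ?g z) * (?g z - e * lap ?g z)"
        using res_eq[OF z, of f] by simp
      also have "\<dots> = ?g z * ?g z - 2 * e * (?g z * lap ?g z) + (e * lap ?g z)\<^sup>2"
        by (simp add: power2_eq_square algebra_simps)
      finally have "?g z * ?g z - 2 * e * (?g z * lap ?g z) \<le> f z * f z" by simp
      moreover have "f z * f z \<le> 1"
        using f[OF z] by (metis abs_ge_zero abs_mult_self_eq mult_le_one)
      moreover have "2 * e * (?u z - e * lap ?u z) = 2 * e * gam ?g ?g z"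
        by (simp add: res_eq z)
      ultimately show "0 \<le> 1 - (?g z * ?g z + 2 * e * ?u z)
          - e * lap (\<lambda>y. 1 - (?g y * ?g y + 2 * e * ?u y)) z"
        unfolding lap_diff lap_add lap_cmult lap_square lap_const by (simp add: algebra_simps)
    qed
    then show ?thesis by simp
  qed
  from this[OF x] have "2 * e * ?u x \<le> 1" by (smt (verit) zero_le_square)
  moreover have "2 * e * gam (res e ?g) (res e ?g) x \<le> 2 * e * ?u x"
    using e gradient_estimate[OF CD x, of ?g] by (intro mult_left_mono) auto
  ultimately show ?thesis by simp
qed

section \<open>The Markov kernel of the squared resolvent\<close>

definition ker :: "'a \<Rightarrow> 'a \<Rightarrow> real" where
  "ker x z = res e (res e (\<lambda>y. if y = z then 1 else 0)) x"

lemma ker_nonneg: "x \<in> V \<Longrightarrow> 0 \<le> ker x z"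
  unfolding ker_def by (intro res_nonneg) auto

text \<open>Linearity of R is a consequence of uniqueness: the superposition of the solutions for
  point masses satisfies the equation defining R f. The argument is applied once for each of the two
  resolvents.\<close>

lemma res_res_eq_sum_ker:
  assumes x: "x \<in> V"
  shows "res e (res e f) x = (\<Sum>z\<in>V. f z * ker x z)"
proof (rule res_unique[OF _ x])
  let ?d = "\<lambda>z y. if y = z then 1 else (0::real)"
  have R: "res e f y = (\<Sum>z\<in>V. f z * res e (?d z) y)" if y: "y \<in> V" for y
  proof (rule res_unique[OF _ y])
    fix y assume y: "y \<in> V"
    have "(\<Sum>z\<in>V. f z * res e (?d z) y) - e * lap (\<lambda>y. \<Sum>z\<in>V. f z * res e (?d z) y) y
        = (\<Sum>z\<in>V. f z * (res e (?d z) y - e * lap (res e (?d z)) y))"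
      unfolding lap_sum lap_cmult by (simp add: sum_distrib_left sum_subtractf algebra_simps)
    also have "\<dots> = f y" using y finite_V by (simp add: res_eq if_distrib cong: if_cong)
    finally show "(\<Sum>z\<in>V. f z * res e (?d z) y) - e * lap (\<lambda>y. \<Sum>z\<in>V. f z * res e (?d z) y) y
        = f y" .
  qed
  fix y assume y: "y \<in> V"
  have "(\<Sum>z\<in>V. f z * ker y z) - e * lap (\<lambda>y. \<Sum>z\<in>V. f z * ker y z) y
      = (\<Sum>z\<in>V. f z * (ker y z - e * lap (\<lambda>y. ker y z) y))"
    unfolding lap_sum lap_cmult by (simp add: sum_distrib_left sum_subtractf algebra_simps)
  also have "\<dots> = res e f y" unfolding ker_def by (simp add: res_eq R y)
  finally show "(\<Sum>z\<in>V. f z * ker y z) - e * lap (\<lambda>y. \<Sum>z\<in>V. f z * ker y z) y = res e f y" .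
qed

text \<open>Self-adjointness moves both resolvents from the point mass at \<open>z\<close> onto
  \<open>f\<close>. Thus columns of the kernel, too, integrate functions to values of R^2.\<close>

lemma sum_mult_ker:
  assumes z: "z \<in> V"
  shows "(\<Sum>x\<in>V. f x * ker x z) = res e (res e f) z"
  unfolding ker_def using z finite_V
  by (simp add: res_self_adjoint[symmetric] if_distrib cong: if_cong)

lemma sum_ker: "z \<in> V \<Longrightarrow> (\<Sum>x\<in>V. ker x z) = 1"
proof -
  assume z: "z \<in> V"
  have "res e (\<lambda>_. 1) x = 1" if "x \<in> V" for x
    by (rule res_unique[OF _ that]) (simp add: lap_const)
  then have "res e (res e (\<lambda>_. 1)) z = 1"
    by (intro res_unique[OF _ z]) (simp add: lap_const)
  then show ?thesis using sum_mult_ker[OF z, of "\<lambda>_. 1"] by simp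
qed

text \<open>The l^1 distance is realised by testing against the sign \<open>f\<close> of the
  difference. Since \<open>f\<close> is bounded by 1, \<open>reverse_poincare\<close> applies to it,
  and the square over the single edge from \<open>x\<close> to \<open>y\<close> is at most 2
  \<Gamma>(R^2 f) at \<open>x\<close>.\<close>

lemma ker_variation:
  assumes CD: "\<And>f x. x \<in> V \<Longrightarrow> 0 \<le> gamma_op V q 2 f f x"
    and x: "x \<in> V" and y: "y \<in> V" and xy: "q x y = 1" and e0: "0 < e"
  shows "(\<Sum>z\<in>V. \<bar>ker y z - ker x z\<bar>) \<le> 1 / sqrt e"
proof -
  define f where "f z = sgn (ker y z - ker x z)" for z
  let ?k = "res e (res e f)"
  have "(?k y - ?k x)\<^sup>2 = q x y * ((?k y - ?k x) * (?k y - ?k x))"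
    by (simp add: xy power2_eq_square)
  also have "\<dots> \<le> (\<Sum>y\<in>V. q x y * ((?k y - ?k x) * (?k y - ?k x)))"
    using x y finite_V by (intro member_le_sum[where i = y]) (use x edge_square_nonneg in auto)
  also have "\<dots> = 2 * gam ?k ?k x" by (simp add: grad_prod_def)
  also have "\<dots> \<le> 1 / e"
    using reverse_poincare[OF CD _ x, of f] e0 by (simp add: f_def abs_sgn_eq field_simps)
  finally have "\<bar>?k y - ?k x\<bar> \<le> 1 / sqrt e"
    using real_le_rsqrt real_sqrt_divide
    by (metis power2_abs real_sqrt_one)
  moreover have "?k y - ?k x = (\<Sum>z\<in>V. \<bar>ker y z - ker x z\<bar>)"
    unfolding res_res_eq_sum_ker[OF x] res_res_eq_sum_ker[OF y]
    by (simp add: sum_subtractf[symmetric] f_def abs_sgn algebra_simps)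
  ultimately show ?thesis by simp
qed

text \<open>Since \<open>f\<close> grows by at most 1 along edges, \<open>lap f \<le> D\<close>, so
  f + e D is a supersolution for R f. Each of the two resolvents therefore costs at most e
  D.\<close>

lemma ker_displacement:
  assumes f: "\<And>x y. \<lbrakk>x \<in> V; y \<in> V; q x y = 1\<rbrakk> \<Longrightarrow> f y \<le> f x + 1" and z: "z \<in> V"
  shows "(\<Sum>x\<in>V. f x * ker x z) \<le> f z + 2 * e * real D"
proof -
  have lap: "lap f x \<le> real D" if x: "x \<in> V" for x
  proof -
    have "lap f x \<le> (\<Sum>y\<in>V. q x y)"
      unfolding laplacian_def using q_01 f x by (intro sum_mono) fastforce
    then show ?thesis using q_sum x by simp
  qed
  have 1: "res e f x \<le> f x + e * real D" if "x \<in> V" for x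
    by (rule res_le[OF _ that]) (use lap e in \<open>simp add: lap_add lap_const mult_left_mono\<close>)
  \<comment> \<open>The second supersolution is R f + e D: 1 - e \<Delta> maps it to f + e D, which
    dominates R f by the first bound.\<close>
  have "res e (res e f) z \<le> res e f z + e * real D"
  proof (rule res_le[OF _ z])
    fix x assume x: "x \<in> V"
    show "res e f x \<le> res e f x + e * real D - e * lap (\<lambda>x. res e f x + e * real D) x"
      using 1[OF x] res_eq[OF x, of f] by (simp add: lap_add lap_const)
  qed
  then show ?thesis using 1[OF z] sum_mult_ker[OF z, of f] by simp
qed

end

section \<open>Balls, their volume, and the tail of the kernel\<close>

primrec gball :: "'a \<Rightarrow> nat \<Rightarrow> 'a set" where
  "gball z 0 = {z}"
| "gball z (Suc k) = gball z k \<union> (\<Union>x\<in>gball z k. {y \<in> V. q x y = 1})"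

lemma gball_subset: "z \<in> V \<Longrightarrow> gball z k \<subseteq> V"
  by (induction k) auto

lemma center_in_gball: "z \<in> gball z k"
  by (induction k) auto

lemma gball_mono: "k \<le> l \<Longrightarrow> gball z k \<subseteq> gball z l"
  by (rule lift_Suc_mono_le[of "gball z"]) auto

lemma card_neighbours: "x \<in> V \<Longrightarrow> card {y \<in> V. q x y = 1} = D"
proof -
  assume x: "x \<in> V"
  have "real (card {y \<in> V. q x y = 1}) = (\<Sum>y\<in>V. if q x y = 1 then 1 else 0)"
    using finite_V by (simp add: sum.inter_filter[symmetric])
  also have "\<dots> = (\<Sum>y\<in>V. q x y)"
    using q_01[OF x] by (intro sum.cong) auto
  finally show ?thesis using q_sum[OF x] by simp
qed

text \<open>Each step adds at most \<open>D\<close> neighbours per point. The bound is crude, but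
  what matters is that it does not depend on \<open>card V\<close>.\<close>

lemma card_gball: "z \<in> V \<Longrightarrow> card (gball z k) \<le> (1 + D) ^ k"
proof (induction k)
  case (Suc k)
  note sub = gball_subset[OF Suc.prems, of k]
  have fin: "finite (gball z k)" using finite_subset[OF sub finite_V] .
  have "card (gball z (Suc k))
      \<le> card (gball z k) + card (\<Union>x\<in>gball z k. {y \<in> V. q x y = 1})"
    by (simp add: card_Un_le)
  also have "card (\<Union>x\<in>gball z k. {y \<in> V. q x y = 1})
      \<le> (\<Sum>x\<in>gball z k. card {y \<in> V. q x y = 1})"
    by (rule card_UN_le[OF fin])
  also have "\<dots> = card (gball z k) * D"
    using sub card_neighbours by (simp add: subset_iff)
  finally have "card (gball z (Suc k)) \<le> card (gball z k) * (1 + D)" by simp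
  also have "\<dots> \<le> (1 + D) ^ k * (1 + D)" using Suc by (intro mult_right_mono) auto
  finally show ?case by (simp add: mult.commute)
qed simp

text \<open>Markov's inequality: the truncated distance vanishes at \<open>z\<close>, equals
  \<open>r\<close> off the ball, and has mean bounded by \<open>ker_displacement\<close>.\<close>

lemma ker_tail:
  assumes e: "0 \<le> e" and z: "z \<in> V"
  shows "real r * (\<Sum>x\<in>V - gball z r. ker e x z) \<le> 2 * e * real D"
proof -
  \<comment> \<open>the distance to \<open>z\<close>, truncated at \<open>r\<close>\<close>
  define f where "f y = (\<Sum>k<r. if y \<in> gball z k then 0 else 1 :: real)" for y
  have f_nonneg: "0 \<le> f y" for y unfolding f_def by (intro sum_nonneg) auto
  have lip: "f y \<le> f x + 1" if "x \<in> V" "y \<in> V" "q x y = 1" for x y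
  proof -
    \<comment> \<open>One extra term allows an index shift: if \<open>y\<close> is outside the ball
      of radius \<open>k + 1\<close>, then its neighbour \<open>x\<close> is outside the ball of
      radius \<open>k\<close>. The term of radius 0 accounts for the 1.\<close>
    have "f y \<le> (\<Sum>k<Suc r. if y \<in> gball z k then 0 else 1 :: real)"
      unfolding f_def by simp
    also have "\<dots> = (if y \<in> gball z 0 then 0 else 1)
        + (\<Sum>k<r. if y \<in> gball z (Suc k) then 0 else 1 :: real)"
      by (rule sum.lessThan_Suc_shift)
    also have "\<dots> \<le> 1 + f x"
      unfolding f_def using that by (intro add_mono sum_mono) auto
    finally show ?thesis by simp
  qed
  have "real r * (\<Sum>x\<in>V - gball z r. ker e x z) = (\<Sum>x\<in>V - gball z r. f x * ker e x z)"
  proof -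
    have "f x = real r" if x: "x \<notin> gball z r" for x
    proof -
      have "x \<notin> gball z k" if "k < r" for k
        using gball_mono[of k r z] that x by auto
      then show ?thesis by (simp add: f_def)
    qed
    then show ?thesis by (simp add: sum_distrib_left)
  qed
  also have "\<dots> \<le> (\<Sum>x\<in>V. f x * ker e x z)"
    using finite_V f_nonneg ker_nonneg[OF e] by (intro sum_mono2) auto
  also have "\<dots> \<le> f z + 2 * e * real D" by (rule ker_displacement[OF e lip z])
  also have "f z = 0" by (simp add: f_def center_in_gball)
  finally show ?thesis by simp
qed

section \<open>Square roots of the kernel tested against the spectral gap\<close>

lemma sum_sqrt_squared_le:
  assumes "finite A" and "\<And>x. x \<in> A \<Longrightarrow> 0 \<le> p x"
  shows "(\<Sum>x\<in>A. sqrt (p x))\<^sup>2 \<le> real (card A) * (\<Sum>x\<in>A. p x)"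
  using sum_squared_le_sum_of_squares[of "\<lambda>x. sqrt (p x)" A] assms
  by (simp add: mult.commute[of "real (card A)"])

text \<open>By Cauchy-Schwarz on each piece, the ball contributes little because it has few points,
  and its complement because it carries little mass. Relative to \<open>card V\<close>, the square
  root of a column thus has a small mean part.\<close>

lemma sum_sqrt_ker:
  assumes e: "0 \<le> e" and z: "z \<in> V" and r: "0 < r"
  shows "(\<Sum>x\<in>V. sqrt (ker e x z))\<^sup>2
    \<le> 2 * (1 + real D) ^ r + 2 * real (card V) * (2 * e * real D / real r)"
proof -
  let ?B = "gball z r" and ?p = "\<lambda>x. ker e x z"
  note sub = gball_subset[OF z, of r]
  have fin: "finite ?B" using finite_subset[OF sub finite_V] .
  have "(\<Sum>x\<in>V. sqrt (?p x)) = (\<Sum>x\<in>V - ?B. sqrt (?p x)) + (\<Sum>x\<in>?B. sqrt (?p x))"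
    by (rule sum.subset_diff[OF sub finite_V])
  then have "(\<Sum>x\<in>V. sqrt (?p x))\<^sup>2
      \<le> 2 * (\<Sum>x\<in>?B. sqrt (?p x))\<^sup>2 + 2 * (\<Sum>x\<in>V - ?B. sqrt (?p x))\<^sup>2"
    using sum_squares_bound[of "\<Sum>x\<in>V - ?B. sqrt (?p x)" "\<Sum>x\<in>?B. sqrt (?p x)"]
    by (simp add: power2_sum)
  also have "(\<Sum>x\<in>?B. sqrt (?p x))\<^sup>2 \<le> (1 + real D) ^ r"
  proof -
    have "(\<Sum>x\<in>?B. sqrt (?p x))\<^sup>2 \<le> real (card ?B) * (\<Sum>x\<in>?B. ?p x)"
      using fin sub ker_nonneg[OF e] by (intro sum_sqrt_squared_le) auto
    also have "\<dots> \<le> real (card ?B) * (\<Sum>x\<in>V. ?p x)"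
      using finite_V sub ker_nonneg[OF e] by (intro mult_left_mono sum_mono2) auto
    also have "\<dots> = real (card ?B)" by (simp add: sum_ker[OF e z])
    also have "real (card ?B) \<le> real ((1 + D) ^ r)" using card_gball[OF z] of_nat_le_iff by blast
    finally show ?thesis by simp
  qed
  also have "(\<Sum>x\<in>V - ?B. sqrt (?p x))\<^sup>2 \<le> real (card V) * (2 * e * real D / real r)"
  proof -
    have "(\<Sum>x\<in>V - ?B. sqrt (?p x))\<^sup>2 \<le> real (card (V - ?B)) * (\<Sum>x\<in>V - ?B. ?p x)"
      using finite_V ker_nonneg[OF e] by (intro sum_sqrt_squared_le) auto
    also have "\<dots> \<le> real (card V) * (2 * e * real D / real r)"
      using ker_tail[OF e z, of r] r finite_V ker_nonneg[OF e]
      by (intro mult_mono sum_nonneg) (auto simp: field_simps intro: card_mono)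
    finally show ?thesis .
  qed
  finally show ?thesis by simp
qed

text \<open>The gap inequality is tested on every column \<open>f z\<close>, a unit vector with
  small mean part, and the results are summed over \<open>z\<close>. After exchanging sums, the
  energy at \<open>x\<close> is half the sum of the squared distances of \<xi>_x to its
  \<open>D\<close> neighbours.\<close>

lemma spectral_gap_bound:
  assumes CD: "\<And>f x. x \<in> V \<Longrightarrow> 0 \<le> gamma_op V q 2 f f x"
    and l: "0 \<le> l"
    and gap: "\<And>f. l * ((\<Sum>x\<in>V. (f x)\<^sup>2) - (\<Sum>x\<in>V. f x)\<^sup>2 / real (card V)) \<le> (\<Sum>x\<in>V. gam f f x)"
    and e: "0 < e" and r: "0 < r" and V: "V \<noteq> {}"
  shows "l * (1 - 2 * (1 + real D) ^ r / real (card V) - 4 * e * real D / real r)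
    \<le> real D / (2 * sqrt e)"
proof -
  let ?N = "real (card V)"
  have e': "0 \<le> e" using e by simp
  have N: "0 < ?N" using V finite_V by (simp add: card_gt_0_iff)
  define f where "f z x = sqrt (ker e x z)" for z x
  let ?b = "2 * (1 + real D) ^ r + 2 * ?N * (2 * e * real D / real r)"
  have "l * (1 - ?b / ?N) \<le> (\<Sum>x\<in>V. gam (f z) (f z) x)" if z: "z \<in> V" for z
  proof -
    have "(\<Sum>x\<in>V. (f z x)\<^sup>2) = 1"
      using sum_ker[OF e' z] ker_nonneg[OF e'] by (simp add: f_def)
    moreover have "(\<Sum>x\<in>V. f z x)\<^sup>2 / ?N \<le> ?b / ?N"
      unfolding f_def using sum_sqrt_ker[OF e' z r] by (intro divide_right_mono) auto
    ultimately have "l * (1 - ?b / ?N) \<le> l * ((\<Sum>x\<in>V. (f z x)\<^sup>2) - (\<Sum>x\<in>V. f z x)\<^sup>2 / ?N)"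
      using l by (intro mult_left_mono) auto
    then show ?thesis using gap[of "f z"] by simp
  qed
  then have "(\<Sum>z\<in>V. l * (1 - ?b / ?N)) \<le> (\<Sum>z\<in>V. \<Sum>x\<in>V. gam (f z) (f z) x)"
    by (rule sum_mono)
  also have "\<dots> = (\<Sum>x\<in>V. \<Sum>z\<in>V. gam (f z) (f z) x)" by (rule sum.swap)
  also have "\<dots> \<le> (\<Sum>x\<in>V. real D / (2 * sqrt e))"
  proof (rule sum_mono)
    fix x assume x: "x \<in> V"
    have "(\<Sum>z\<in>V. gam (f z) (f z) x)
        = (\<Sum>z\<in>V. \<Sum>y\<in>V. q x y * (f z y - f z x)\<^sup>2) / 2"
      unfolding grad_prod_def by (simp add: sum_divide_distrib power2_eq_square)
    also have "(\<Sum>z\<in>V. \<Sum>y\<in>V. q x y * (f z y - f z x)\<^sup>2)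
        = (\<Sum>y\<in>V. q x y * (\<Sum>z\<in>V. (f z y - f z x)\<^sup>2))"
      unfolding sum_distrib_left by (rule sum.swap)
    also have "\<dots> \<le> (\<Sum>y\<in>V. q x y * (1 / sqrt e))"
    proof (rule sum_mono)
      fix y assume y: "y \<in> V"
      show "q x y * (\<Sum>z\<in>V. (f z y - f z x)\<^sup>2) \<le> q x y * (1 / sqrt e)"
      proof (cases "q x y = 1")
        case True
        \<comment> \<open>The squared Hellinger distance is at most the l^1 distance, because the
          difference of two square roots is at most their sum.\<close>
        have "(\<Sum>z\<in>V. (f z y - f z x)\<^sup>2) \<le> (\<Sum>z\<in>V. \<bar>ker e y z - ker e x z\<bar>)"
        proof (rule sum_mono)
          fix z
          have sq: "(sqrt a - sqrt b)\<^sup>2 \<le> \<bar>a - b\<bar>" if "0 \<le> a" "0 \<le> b" for a b :: real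
          proof -
            have "\<bar>sqrt a - sqrt b\<bar> * \<bar>sqrt a - sqrt b\<bar>
                \<le> \<bar>sqrt a - sqrt b\<bar> * \<bar>sqrt a + sqrt b\<bar>"
              using that by (intro mult_left_mono) (auto simp: abs_le_iff)
            also have "\<dots> = \<bar>(sqrt a - sqrt b) * (sqrt a + sqrt b)\<bar>" by (simp add: abs_mult)
            also have "(sqrt a - sqrt b) * (sqrt a + sqrt b) = a - b"
              using that by (simp add: algebra_simps)
            finally show ?thesis by (simp add: power2_eq_square)
          qed
          show "(f z y - f z x)\<^sup>2 \<le> \<bar>ker e y z - ker e x z\<bar>"
            unfolding f_def using x y ker_nonneg[OF e'] by (intro sq) auto
        qed
        then show ?thesis using ker_variation[OF e' CD x y True e] True by simp
      next
        case False
        then show ?thesis using q_01[OF x y] by simp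
      qed
    qed
    also have "\<dots> = real D / sqrt e" by (simp add: sum_divide_distrib[symmetric] q_sum x)
    finally show "(\<Sum>z\<in>V. gam (f z) (f z) x) \<le> real D / (2 * sqrt e)" by simp
  qed
  finally have "?N * (l * (1 - ?b / ?N)) \<le> ?N * (real D / (2 * sqrt e))" by simp
  then have "l * (1 - ?b / ?N) \<le> real D / (2 * sqrt e)" using N by (rule mult_left_le_imp_le)
  moreover have "?b / ?N = 2 * (1 + real D) ^ r / ?N + 4 * e * real D / real r"
    using N by (simp add: add_divide_distrib)
  ultimately show ?thesis by (simp only: diff_diff_eq)
qed


section \<open>The Poincare inequality from the first positive eigenvalue\<close>

lemma compact_unit_sphere_mean_zero:
  "compact {f :: 'a \<Rightarrow> real. (\<forall>x. x \<notin> V \<longrightarrow> f x = 0) \<and> (\<Sum>x\<in>V. f x) = 0 \<and> (\<Sum>x\<in>V. (f x)\<^sup>2) = 1}"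
  (is "compact ?S")
proof -
  \<comment> \<open>The type \<open>'a\<close> may be infinite, so compactness is that of a cube in
    the product topology (Tychonoff). Vanishing off \<open>V\<close> keeps the remaining coordinates
    inside the cube.\<close>
  have 1: "compact (PiE UNIV (\<lambda>_. {-1..1}) :: ('a \<Rightarrow> real) set)"
    using compactin_PiE[of "\<lambda>_. euclidean :: real topology" "UNIV :: 'a set" "\<lambda>_. {-1..1}"]
    by (simp add: euclidean_product_topology)
  have "closed ?S"
    unfolding Collect_conj_eq Collect_all_eq imp_conv_disj Collect_disj_eq
    by (intro closed_Int closed_INT ballI closed_Un closed_Collect_eq closed_Collect_const
        continuous_intros continuous_on_product_coordinates)
  then have 2: "compact (PiE UNIV (\<lambda>_. {-1..1}) \<inter> ?S)"
    using 1 by (rule compact_Int_closed[rotated])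
  have "f \<in> PiE UNIV (\<lambda>_. {-1..1})" if f: "f \<in> ?S" for f
  proof -
    have "\<bar>f x\<bar> \<le> 1" for x
    proof (cases "x \<in> V")
      case True
      have "(f x)\<^sup>2 \<le> (\<Sum>x\<in>V. (f x)\<^sup>2)"
        using True finite_V by (intro member_le_sum) auto
      then show ?thesis using f by (simp add: abs_square_le_1)
    qed (use f in auto)
    then show ?thesis by (auto simp: abs_le_iff minus_le_iff)
  qed
  then have "PiE UNIV (\<lambda>_. {-1..1}) \<inter> ?S = ?S" by blast
  then show ?thesis using 2 by simp
qed

text \<open>Direct method: a minimiser of the energy on the mean zero unit sphere is an
  eigenfunction whose eigenvalue is the minimum \<open>m\<close>. Connectedness gives
  \<open>m > 0\<close>, hence \<open>\<mu> \<le> m\<close>; a general \<open>f\<close> is centred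
  first.\<close>

lemma poincare_inequality:
  assumes conn: "connected_graph V q" and fpe: "first_positive_eigenvalue V q \<mu>" and l: "l \<le> \<mu>"
  shows "l * ((\<Sum>x\<in>V. (f x)\<^sup>2) - (\<Sum>x\<in>V. f x)\<^sup>2 / real (card V)) \<le> (\<Sum>x\<in>V. gam f f x)"
proof -
  let ?S = "{f :: 'a \<Rightarrow> real. (\<forall>x. x \<notin> V \<longrightarrow> f x = 0) \<and> (\<Sum>x\<in>V. f x) = 0 \<and> (\<Sum>x\<in>V. (f x)\<^sup>2) = 1}"
  let ?E = "\<lambda>f. \<Sum>x\<in>V. gam f f x"
  let ?n = "\<lambda>f. \<Sum>x\<in>V. (f x)\<^sup>2 :: real"
  have E_nonneg: "0 \<le> ?E f" for f by (intro sum_nonneg gam_self_nonneg)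
  have n_nonneg: "0 \<le> ?n f" for f by (intro sum_nonneg) auto
  have gam_eq: "gam (\<lambda>x. c * f x + d) (\<lambda>x. c * f x + d) x = c\<^sup>2 * gam f f x" for c d f x
    unfolding grad_prod_def
    by (simp add: sum_distrib_left power2_eq_square algebra_simps)
  have gam_if: "?E (\<lambda>x. if x \<in> V then f x else 0) = ?E f" for f
    by (intro sum.cong refl gam_cong) auto
  have normalize: "\<exists>s\<in>?S. ?E s * ?n f = ?E f" if "(\<Sum>x\<in>V. f x) = 0" "?n f \<noteq> 0" for f
  proof
    define c where "c = 1 / sqrt (?n f)"
    have c2: "c\<^sup>2 * ?n f = 1"
      using that n_nonneg[of f] by (simp add: c_def power_divide)
    \<comment> \<open>The \<open>+ 0\<close> brings the function into the shape of
      \<open>gam_eq\<close>.\<close>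
    let ?s = "\<lambda>x. if x \<in> V then c * f x + 0 else 0"
    show "?s \<in> ?S"
      using that c2 by (simp add: sum_distrib_left[symmetric] power_mult_distrib)
    show "?E ?s * ?n f = ?E f"
      unfolding gam_if gam_eq using c2 by (simp add: sum_distrib_left[symmetric])
  qed
  have mean_zero: "l * ?n f \<le> ?E f" if f: "(\<Sum>x\<in>V. f x) = 0" for f
  proof (cases "?n f = 0")
    case True
    then show ?thesis using E_nonneg by simp
  next
    case False
    then have "?S \<noteq> {}" using normalize[OF f] by blast
    moreover have "continuous_on ?S ?E"
      unfolding grad_prod_def
      by (intro continuous_intros continuous_on_subset[OF continuous_on_product_coordinates]) auto
    ultimately have "\<exists>s\<in>?S. \<forall>g\<in>?S. ?E s \<le> ?E g"
      by (rule continuous_attains_inf[OF compact_unit_sphere_mean_zero])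
    then obtain s where s: "s \<in> ?S" and s_min: "\<And>g. g \<in> ?S \<Longrightarrow> ?E s \<le> ?E g" by blast
    define m where "m = ?E s"
    have min: "m * ?n g \<le> ?E g" if g: "(\<Sum>x\<in>V. g x) = 0" for g
    proof (cases "?n g = 0")
      case True
      then show ?thesis using E_nonneg by simp
    next
      case False
      then obtain s' where s': "s' \<in> ?S" "?E s' * ?n g = ?E g" using normalize[OF g] by blast
      have "m * ?n g \<le> ?E s' * ?n g"
        unfolding m_def by (rule mult_right_mono[OF s_min[OF s'(1)] n_nonneg])
      then show ?thesis unfolding s'(2) .
    qed
    \<comment> \<open>first variation of the energy at the minimiser \<open>s\<close>, in the direction of the defect \<open>w\<close>\<close>
    define w where "w x = - lap s x - m * s x" for x
    have w_mean: "(\<Sum>x\<in>V. w x) = 0"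
      using s by (simp add: w_def sum_subtractf sum_negf sum_lap sum_distrib_left[symmetric])
    define c where "c = ?E w - m * ?n w"
    \<comment> \<open>This is the minimality inequality at \<open>s + t w\<close>. The constant
      terms cancel since \<open>s\<close> has norm 1 and energy \<open>m\<close>, and by
      \<open>green\<close> the linear coefficient is twice the squared norm of
      \<open>w\<close>.\<close>
    have var: "0 \<le> 2 * t * ?n w + t\<^sup>2 * c" for t
    proof -
      let ?g = "\<lambda>x. s x + t * w x"
      have "(\<Sum>x\<in>V. ?g x) = 0"
        using s w_mean by (simp add: sum.distrib sum_distrib_left[symmetric])
      from min[OF this] have "m * ?n ?g \<le> ?E ?g" .
      moreover have "?E ?g = m + 2 * t * (\<Sum>x\<in>V. gam w s x) + t\<^sup>2 * ?E w"
      proof -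
        have "gam ?g ?g x = gam s s x + 2 * t * gam w s x + t\<^sup>2 * gam w w x" for x
        proof -
          have "(\<Sum>y\<in>V. q x y * ((?g y - ?g x) * (?g y - ?g x)))
            = (\<Sum>y\<in>V. q x y * ((s y - s x) * (s y - s x))
                + 2 * t * (q x y * ((w y - w x) * (s y - s x)))
                + t\<^sup>2 * (q x y * ((w y - w x) * (w y - w x))))"
            by (intro sum.cong refl) algebra
          then show ?thesis
            unfolding grad_prod_def sum.distrib sum_distrib_left[symmetric]
            by (simp add: add_divide_distrib)
        qed
        then show ?thesis by (simp add: m_def sum.distrib sum_distrib_left)
      qed
      moreover have "?n ?g = 1 + 2 * t * (\<Sum>x\<in>V. w x * s x) + t\<^sup>2 * ?n w"
      proof -
        have "?n ?g = (\<Sum>x\<in>V. (s x)\<^sup>2 + 2 * t * (w x * s x) + t\<^sup>2 * (w x)\<^sup>2)"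
          by (intro sum.cong refl) algebra
        then show ?thesis using s by (simp add: sum.distrib sum_distrib_left)
      qed
      moreover have "(\<Sum>x\<in>V. gam w s x) = ?n w + m * (\<Sum>x\<in>V. w x * s x)"
      proof -
        have "(\<Sum>x\<in>V. gam w s x) = (\<Sum>x\<in>V. - (w x * lap s x))"
          using green[of w s] by (simp add: sum_negf)
        also have "\<dots> = (\<Sum>x\<in>V. (w x)\<^sup>2 + m * (w x * s x))"
          by (intro sum.cong refl) (simp add: w_def power2_eq_square algebra_simps)
        finally show ?thesis by (simp add: sum.distrib sum_distrib_left)
      qed
      ultimately show ?thesis by (simp add: c_def algebra_simps)
    qed
    have "?n w = 0"
    proof (rule ccontr)
      assume "?n w \<noteq> 0"
      then have n: "0 < ?n w" using n_nonneg[of w] by simp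
      \<comment> \<open>A negative \<open>t\<close> so small that the quadratic term is at most half
        the linear one in size: the right side of \<open>var\<close> is then at most
        \<open>t * ?n w\<close>, which is negative.\<close>
      define t where "t = - ?n w / (\<bar>c\<bar> + 1)"
      have "t * (\<bar>c\<bar> + 1) = - ?n w" by (simp add: t_def field_simps)
      then have "t\<^sup>2 * (\<bar>c\<bar> + 1) = - t * ?n w" by (simp add: power2_eq_square mult.assoc)
      moreover have "t < 0" using n by (simp add: t_def divide_neg_pos)
      moreover have "t\<^sup>2 * c \<le> t\<^sup>2 * (\<bar>c\<bar> + 1)" by (intro mult_left_mono) auto
      ultimately have "0 \<le> t * ?n w" using var[of t] by linarith
      with \<open>t < 0\<close> n show False by (simp add: zero_le_mult_iff)
    qed
    then have w0: "w x = 0" if "x \<in> V" for x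
      using that finite_V by (simp add: sum_nonneg_eq_0_iff)
    have s_nz: "\<exists>x\<in>V. s x \<noteq> 0"
    proof (rule ccontr)
      assume "\<not> ?thesis"
      then have "?n s = 0" by simp
      then show False using s by simp
    qed
    then have eig: "eigenvalue_neg_laplacian V q m"
      unfolding eigenvalue_neg_laplacian_def using w0 by (auto simp: w_def)
    \<comment> \<open>With zero energy, \<open>s\<close> is constant along edges and so on the
      connected graph; having mean zero it would vanish, contradicting \<open>s_nz\<close>.\<close>
    have "m \<noteq> 0"
    proof
      assume "m = 0"
      then have z: "gam s s x = 0" if "x \<in> V" for x
        using that finite_V gam_self_nonneg by (simp add: m_def sum_nonneg_eq_0_iff)
      have edge: "s y = s x" if "x \<in> V" "y \<in> V" "0 < q x y" for x y
      proof -
        have "(\<Sum>y\<in>V. q x y * ((s y - s x) * (s y - s x))) = 0"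
          using z[OF that(1)] by (simp add: grad_prod_def)
        moreover have "0 \<le> q x y * ((s y - s x) * (s y - s x))" if "y \<in> V" for y
          using q_nonneg[OF \<open>x \<in> V\<close> that] by (rule mult_nonneg_nonneg) simp
        ultimately have "q x y * ((s y - s x) * (s y - s x)) = 0"
          using that finite_V by (metis (no_types, lifting) sum_nonneg_eq_0_iff)
        then show ?thesis using that by simp
      qed
      have const: "s y = s x" if "x \<in> V" "y \<in> V" for x y
      proof -
        have "(x, y) \<in> {(u, v). u \<in> V \<and> v \<in> V \<and> 0 < q u v}\<^sup>*"
          using conn that by (simp add: connected_graph_def)
        then show ?thesis by (induction rule: rtrancl_induct) (auto dest: edge)
      qed
      obtain x where x: "x \<in> V" "s x \<noteq> 0" using s_nz by blast
      have "(\<Sum>y\<in>V. s y) = (\<Sum>y\<in>V. s x)"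
        by (intro sum.cong refl const x(1))
      then show False using s x finite_V by auto
    qed
    moreover have "0 \<le> m" unfolding m_def by (rule E_nonneg)
    ultimately have "\<mu> \<le> m" using fpe eig by (simp add: first_positive_eigenvalue_def)
    then have "l * ?n f \<le> m * ?n f" using l n_nonneg by (intro mult_right_mono) auto
    then show ?thesis using min[OF f] by simp
  qed
  define a where "a = (\<Sum>x\<in>V. f x) / real (card V)"
  show ?thesis
  proof (cases "V = {}")
    case False
    then have N: "0 < real (card V)" using finite_V by (simp add: card_gt_0_iff)
    \<comment> \<open>Subtracting the mean leaves the energy unchanged; the factor 1 again matches
      \<open>gam_eq\<close>.\<close>
    let ?g = "\<lambda>x. 1 * f x + (- a)"
    have "(\<Sum>x\<in>V. ?g x) = 0" using N by (simp add: sum_subtractf a_def)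
    moreover have "?n ?g = ?n f - (\<Sum>x\<in>V. f x)\<^sup>2 / real (card V)"
    proof -
      have "?n ?g = (\<Sum>x\<in>V. (f x)\<^sup>2 - 2 * a * f x + a\<^sup>2)"
        by (intro sum.cong refl) algebra
      also have "\<dots> = ?n f - 2 * a * (\<Sum>x\<in>V. f x) + real (card V) * a\<^sup>2"
        by (simp add: sum.distrib sum_subtractf sum_distrib_left)
      finally show ?thesis using N by (simp add: a_def power2_eq_square field_simps)
    qed
    ultimately show ?thesis using mean_zero[of ?g] unfolding gam_eq by simp
  qed simp
qed

end

section \<open>Choice of the parameters and contradiction\<close>

theorem corollary4p2:
  fixes n :: real
  assumes "0 < n"
  shows "\<not> (\<exists>(V :: nat \<Rightarrow> 'a set) (q :: nat \<Rightarrow> 'a \<Rightarrow> 'a \<Rightarrow> real).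
           expander_family V q \<and> (\<forall>i. CD (V i) (q i) 0 n))"
proof
  assume "\<exists>(V :: nat \<Rightarrow> 'a set) (q :: nat \<Rightarrow> 'a \<Rightarrow> 'a \<Rightarrow> real).
           expander_family V q \<and> (\<forall>i. CD (V i) (q i) 0 n)"
  then obtain V :: "nat \<Rightarrow> 'a set" and q :: "nat \<Rightarrow> 'a \<Rightarrow> 'a \<Rightarrow> real"
    where exp: "expander_family V q" and CD: "\<And>i. CD (V i) (q i) 0 n" by blast
  have comb: "combinatorial_undirected (V i) (q i)" and conn: "connected_graph (V i) (q i)"
    and lim: "filterlim (\<lambda>i. card (V i)) at_top sequentially" for i
    using exp by (auto simp: expander_family_def)
  obtain D :: nat where D: "\<And>i x. x \<in> V i \<Longrightarrow> degree (V i) (q i) x = real D"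
    using exp by (auto simp: expander_family_def)
  obtain l where l: "0 < l"
    and fpe: "\<And>i. \<exists>\<mu>. first_positive_eigenvalue (V i) (q i) \<mu> \<and> l \<le> \<mu>"
    using exp by (auto simp: expander_family_def)
  \<comment> \<open>chosen so that \<open>D / (2 * sqrt e) < l / 2\<close>\<close>
  define e where "e = (2 * (real D + 1) / l)\<^sup>2"
  have e: "0 < e" and sqrt_e: "sqrt e = 2 * (real D + 1) / l"
    using l by (auto simp: e_def)
  \<comment> \<open>With \<open>e\<close> fixed, \<open>r\<close> makes the tail term at most 1/4,
    and then \<open>N0\<close> makes the ball term at most 1/4, so half of \<open>l\<close> survives
    on the left. The added 1 ensures that \<open>r\<close> is positive.\<close>
  obtain r :: nat where r: "16 * e * real D + 1 < real r" using reals_Archimedean2 by blast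
  moreover have "0 \<le> 16 * e * real D" using e by simp
  ultimately have r0: "0 < r" by linarith
  obtain N0 :: nat where N0: "8 * (1 + real D) ^ r < real N0" using reals_Archimedean2 by blast
  obtain i where i: "N0 \<le> card (V i)"
    using lim by (auto simp: filterlim_at_top eventually_sequentially)
  interpret regular_graph "V i" "q i" D
    using comb[of i] D[of _ i, unfolded degree_def]
    by unfold_locales (auto simp: combinatorial_undirected_def finite_graph_def)
  have CD0: "0 \<le> gamma_op (V i) (q i) 2 f f x" if "x \<in> V i" for f x
  proof -
    have "0 \<le> 1 / n * (laplacian (V i) (q i) f x)\<^sup>2" using assms by simp
    also have "\<dots> \<le> gamma_op (V i) (q i) 2 f f x" using CD[of i] that by (simp add: CD_def)
    finally show ?thesis .
  qed
  obtain \<mu> where \<mu>: "first_positive_eigenvalue (V i) (q i) \<mu>" "l \<le> \<mu>" using fpe by blast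
  have N: "8 * (1 + real D) ^ r < real (card (V i))" using N0 i by linarith
  have N_pos: "0 < real (card (V i))"
    by (rule le_less_trans[OF _ N]) simp
  then have "V i \<noteq> {}" by auto
  then have bound: "l * (1 - 2 * (1 + real D) ^ r / real (card (V i)) - 4 * e * real D / real r)
      \<le> real D / (2 * sqrt e)"
    using spectral_gap_bound[OF CD0 _ poincare_inequality[OF conn \<mu>] e r0] l by simp
  have "2 * (1 + real D) ^ r / real (card (V i)) \<le> 1 / 4"
    using N N_pos by (simp add: field_simps)
  moreover have "4 * e * real D / real r \<le> 1 / 4"
    using r r0 by (simp add: field_simps)
  ultimately have "1 / 2 \<le> 1 - 2 * (1 + real D) ^ r / real (card (V i)) - 4 * e * real D / real r"
    by linarith
  then have "l * (1 / 2)
      \<le> l * (1 - 2 * (1 + real D) ^ r / real (card (V i)) - 4 * e * real D / real r)"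
    using l by (intro mult_left_mono) auto
  also note bound
  also have "real D / (2 * sqrt e) = l * (real D / (4 * (real D + 1)))"
    using l by (simp add: sqrt_e)
  also have "\<dots> < l * (1 / 2)"
    using l by (intro mult_strict_left_mono) (auto simp: divide_simps)
  finally show False by simp
qed

end
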